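(* Let $(\mathfrak s=\mathfrak a\oplus\mathfrak n,\langle\cdot,\cdot\rangle)$ be a solvable pseudo-Riemannian metric Lie algebra of strong Iwasawa type and let $(\mathfrak s',\langle\cdot,\cdot\rangle')$ be the attached metric subalgebra defined by $\Lambda'\subsetneq\Lambda$. Then $(\mathfrak s',\langle\cdot,\cdot\rangle')$ is totally geodesic in $(\mathfrak s,\langle\cdot,\cdot\rangle)$ if and only if $\Lambda'$ and $\Lambda\setminus\Lambda'$ are orthogonal, i.e. $\langle\alpha,\beta\rangle=0$ in $\mathfrak a^*$ for all $\alpha\in\Lambda'$ and $\beta\in\Lambda\setminus\Lambda'$.
   Context: All Lie algebras are real and finite-dimensional. A (pseudo-Riemannian) metric Lie algebra is a Lie algebra with a nondegenerate symmetric bilinear form (scalar product) $\langle\cdot,\cdot\rangle$. Strong Iwasawa type: a solvable metric Lie algebra $(\mathfrak s,\langle\cdot,\cdot\rangle)$ such that (1) $\mathfrak s=\mathfrak a\oplus\mathfrak n$ where $\mathfrak n=[\mathfrak s,\mathfrak s]$ and $\mathfrak a$ is the orthogonal complement of $\mathfrak n$ and is abelian; (2) for every $A\in\mathfrak a$, $\mathrm{ad}_A$ is symmetric with respect to $\langle\cdot,\cdot\rangle$, and $\mathrm{ad}_A=0$ iff $A=0$; (3) there is $A^0\in\mathfrak a$ such that $\mathrm{ad}_{A^0}|_{\mathfrak n}$ has all eigenvalues positive; (4) $\langle\cdot,\cdot\rangle$ is positive definite on $\mathfrak a$. Roots: for $\alpha\in\mathfrak a^*$, $\mathfrak n_\alpha=\{X\in\mathfrak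 n: [A,X]=\alpha(A)X\ \forall A\in\mathfrak a\}$; $\alpha$ is a root if $\mathfrak n_\alpha\ne0$, and $\Delta$ is the set of roots. It is assumed that $\mathfrak n=\bigoplus_{\alpha\in\Delta}\mathfrak n_\alpha$ (an orthogonal direct sum, with $\langle\cdot,\cdot\rangle$ nondegenerate on each $\mathfrak n_\alpha$). $\mathfrak a^*$ carries the scalar product dual to that of $\mathfrak a$. For a root $\beta$, $\check s_\beta:\mathfrak a^*\to\mathfrak a^*$ is the reflection $\check s_\beta(\alpha)=\alpha-\frac{2\langle\alpha,\beta\rangle}{\langle\beta,\beta\rangle}\beta$. Attached subalgebra: let $\Lambda=\{\alpha_i\}\subseteq\Delta$ be a finite set that is a basis of $\mathfrak a^*$ and such that every root is a linear combination of elements of $\Lambda$ with coefficients in $\mathbb Z_{\ge0}$. Let $\{B_{\alpha_i}\}$ be the dual basis of $\mathfrak a$: $\alpha_i(B_{\alpha_j})=\delta_{ij}$. Let $\Lambda'\subsetneq\Lambda$ and $Z=\sum_{\alpha\in\Lambda\setminus\Lambda'}B_\alpha$. Assume that for every $\alpha_j\in\Lambda'$, $\check s_{\alpha_j}$ permutes the set of roots $\alpha$ with $\alpha(Z)>0$, and $\dim\mathfrak n_\alpha=\dim\mathfrak n_{\check s_{\alpha_j}(\alpha)}$ for each such $\alpha$. The attached subalgebra defined by $\Lambda'$ is $\mathfrak s'=\mathfrak a'\oplus\mathfrak n'$ with $\mathfrak a'=\mathrm{span}\{B_\alpha:\alpha\in\Lambda\setminus\Lambda'\}$, $\mathfrak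 n'=\bigoplus_{\alpha\in\Delta,\,\alpha(Z)>0}\mathfrak n_\alpha$, with the restricted scalar product $\langle\cdot,\cdot\rangle'$. Second fundamental form: for a metric Lie algebra $\mathfrak g$, $U:\mathfrak g\times\mathfrak g\to\mathfrak g$ is the symmetric bilinear map $\langle U(X,Y),W\rangle=\frac12(\langle[W,X],Y\rangle+\langle[W,Y],X\rangle)$ for all $W\in\mathfrak g$. With $U$ for $\mathfrak s$ and $U'$ for $(\mathfrak s',\langle\cdot,\cdot\rangle')$, the second fundamental form of $\mathfrak s'$ in $\mathfrak s$ is $h(X,Y)=U(X,Y)-U'(X,Y)$, $X,Y\in\mathfrak s'$; $\mathfrak s'$ is totally geodesic if $h\equiv0$. *)

theory Defs
  imports "HOL-Analysis.Analysis" "HOL-Library.Function_Algebras"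
begin

text \<open>
  The ambient real vector space is a type of class \<^class>\<open>real_vector\<close> that is assumed to be
  finite-dimensional. The bracket \<open>br\<close> and the scalar product \<open>ip\<close> are explicit functions
  on that type; \<open>ip\<close> need not be definite.
\<close>

definition lie_bracket :: "('a::real_vector \<Rightarrow> 'a \<Rightarrow> 'a) \<Rightarrow> bool" where
  "lie_bracket br \<longleftrightarrow>
     bilinear br \<and> (\<forall>X. br X X = 0) \<and>
     (\<forall>X Y Z. br X (br Y Z) + br Y (br Z X) + br Z (br X Y) = 0)"

definition nondegenerate_on :: "'a::real_vector set \<Rightarrow> ('a \<Rightarrow> 'a \<Rightarrow> real) \<Rightarrow> bool" where
  "nondegenerate_on V ip \<longleftrightarrow> (\<forall>X\<in>V. (\<forall>Y\<in>V. ip X Y = 0) \<longrightarrow> X = 0)"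

definition metric_lie_algebra ::
    "('a::real_vector \<Rightarrow> 'a \<Rightarrow> 'a) \<Rightarrow> ('a \<Rightarrow> 'a \<Rightarrow> real) \<Rightarrow> bool" where
  "metric_lie_algebra br ip \<longleftrightarrow>
     (\<exists>S::'a set. finite S \<and> span S = UNIV) \<and> lie_bracket br \<and>
     bilinear ip \<and> (\<forall>X Y. ip X Y = ip Y X) \<and> nondegenerate_on UNIV ip"

definition bracket_space :: "('a::real_vector \<Rightarrow> 'a \<Rightarrow> 'a) \<Rightarrow> 'a set \<Rightarrow> 'a set \<Rightarrow> 'a set" where
  "bracket_space br V W = span {br X Y | X Y. X \<in> V \<and> Y \<in> W}"

primrec derived_series :: "('a::real_vector \<Rightarrow> 'a \<Rightarrow> 'a) \<Rightarrow> nat \<Rightarrow> 'a set" where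
  "derived_series br 0 = UNIV"
| "derived_series br (Suc k) = bracket_space br (derived_series br k) (derived_series br k)"

definition solvable_lie :: "('a::real_vector \<Rightarrow> 'a \<Rightarrow> 'a) \<Rightarrow> bool" where
  "solvable_lie br \<longleftrightarrow> (\<exists>k. derived_series br k = {0})"

definition orth_complement :: "('a \<Rightarrow> 'a \<Rightarrow> real) \<Rightarrow> 'a set \<Rightarrow> 'a set" where
  "orth_complement ip V = {X. \<forall>Y\<in>V. ip X Y = 0}"

text \<open>
  Eigenvalues are taken over the complex numbers, since an operator that is symmetric for an
  indefinite form may have non-real ones: the two equations below say that \<open>T\<close>, extended
  complex-linearly, sends \<open>X + i Y\<close> to \<open>z (X + i Y)\<close>.
\<close>

definition complex_eigenvalue_on ::
    "'a::real_vector set \<Rightarrow> ('a \<Rightarrow> 'a) \<Rightarrow> complex \<Rightarrow> bool" where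
  "complex_eigenvalue_on V T z \<longleftrightarrow>
     (\<exists>X\<in>V. \<exists>Y\<in>V. (X \<noteq> 0 \<or> Y \<noteq> 0) \<and>
        T X = Re z *\<^sub>R X - Im z *\<^sub>R Y \<and> T Y = Im z *\<^sub>R X + Re z *\<^sub>R Y)"

definition strong_iwasawa ::
    "('a::real_vector \<Rightarrow> 'a \<Rightarrow> 'a) \<Rightarrow> ('a \<Rightarrow> 'a \<Rightarrow> real) \<Rightarrow> 'a set \<Rightarrow> 'a set \<Rightarrow> bool" where
  "strong_iwasawa br ip a n \<longleftrightarrow>
     metric_lie_algebra br ip \<and> solvable_lie br \<and>
     n = bracket_space br UNIV UNIV \<and> a = orth_complement ip n \<and>
     a \<inter> n = {0} \<and> span (a \<union> n) = UNIV \<and>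
     (\<forall>A\<in>a. \<forall>A'\<in>a. br A A' = 0) \<and>
     (\<forall>A\<in>a. (\<forall>X Y. ip (br A X) Y = ip X (br A Y)) \<and> ((\<forall>X. br A X = 0) \<longleftrightarrow> A = 0)) \<and>
     (\<exists>A0\<in>a. \<forall>z. complex_eigenvalue_on n (br A0) z \<longrightarrow> Im z = 0 \<and> Re z > 0) \<and>
     (\<forall>A\<in>a. A \<noteq> 0 \<longrightarrow> ip A A > 0)"

instantiation "fun" :: (type, real_vector) real_vector
begin

definition "scaleR c f = (\<lambda>x. c *\<^sub>R f x)"

instance
  by standard (simp_all add: scaleR_fun_def fun_eq_iff algebra_simps)

end

text \<open>
  A functional on the subspace \<open>V\<close> is represented by its extension by zero outside \<open>V\<close>,
  so that equality of functionals is equality of functions and the dual space of \<open>V\<close> is a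
  subspace of the real vector space \<open>'a \<Rightarrow> real\<close>.
\<close>

definition dual_space :: "'a::real_vector set \<Rightarrow> ('a \<Rightarrow> real) set" where
  "dual_space V =
     {\<alpha>. (\<forall>X\<in>V. \<forall>Y\<in>V. \<alpha> (X + Y) = \<alpha> X + \<alpha> Y) \<and> (\<forall>X\<in>V. \<forall>c. \<alpha> (c *\<^sub>R X) = c * \<alpha> X) \<and>
          (\<forall>X. X \<notin> V \<longrightarrow> \<alpha> X = 0)}"

definition dual_vector ::
    "('a::real_vector \<Rightarrow> 'a \<Rightarrow> real) \<Rightarrow> 'a set \<Rightarrow> ('a \<Rightarrow> real) \<Rightarrow> 'a" where
  "dual_vector ip V \<alpha> = (THE A. A \<in> V \<and> (\<forall>X\<in>V. ip A X = \<alpha> X))"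

definition dual_ip ::
    "('a::real_vector \<Rightarrow> 'a \<Rightarrow> real) \<Rightarrow> 'a set \<Rightarrow> ('a \<Rightarrow> real) \<Rightarrow> ('a \<Rightarrow> real) \<Rightarrow> real" where
  "dual_ip ip V \<alpha> \<beta> = ip (dual_vector ip V \<alpha>) (dual_vector ip V \<beta>)"

definition dual_reflection ::
    "('a::real_vector \<Rightarrow> 'a \<Rightarrow> real) \<Rightarrow> 'a set \<Rightarrow> ('a \<Rightarrow> real) \<Rightarrow> ('a \<Rightarrow> real) \<Rightarrow> ('a \<Rightarrow> real)" where
  "dual_reflection ip V \<beta> \<alpha> = \<alpha> - (2 * dual_ip ip V \<alpha> \<beta> / dual_ip ip V \<beta> \<beta>) *\<^sub>R \<beta>"

definition root_space ::
    "('a::real_vector \<Rightarrow> 'a \<Rightarrow> 'a) \<Rightarrow> 'a set \<Rightarrow> 'a set \<Rightarrow> ('a \<Rightarrow> real) \<Rightarrow> 'a set" where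
  "root_space br a n \<alpha> = {X \<in> n. \<forall>A\<in>a. br A X = \<alpha> A *\<^sub>R X}"

definition roots ::
    "('a::real_vector \<Rightarrow> 'a \<Rightarrow> 'a) \<Rightarrow> 'a set \<Rightarrow> 'a set \<Rightarrow> ('a \<Rightarrow> real) set" where
  "roots br a n = {\<alpha> \<in> dual_space a. root_space br a n \<alpha> \<noteq> {0}}"

definition internal_direct_sum :: "'i set \<Rightarrow> ('i \<Rightarrow> 'a::real_vector set) \<Rightarrow> 'a set \<Rightarrow> bool" where
  "internal_direct_sum I V W \<longleftrightarrow>
     span (\<Union>i\<in>I. V i) = W \<and>
     (\<forall>F x. finite F \<and> F \<subseteq> I \<and> (\<forall>i\<in>F. x i \<in> V i) \<and> (\<Sum>i\<in>F. x i) = 0 \<longrightarrow> (\<forall>i\<in>F. x i = 0))"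

definition root_decomposition ::
    "('a::real_vector \<Rightarrow> 'a \<Rightarrow> 'a) \<Rightarrow> ('a \<Rightarrow> 'a \<Rightarrow> real) \<Rightarrow> 'a set \<Rightarrow> 'a set \<Rightarrow> bool" where
  "root_decomposition br ip a n \<longleftrightarrow>
     internal_direct_sum (roots br a n) (root_space br a n) n \<and>
     (\<forall>\<alpha>\<in>roots br a n. \<forall>\<beta>\<in>roots br a n. \<alpha> \<noteq> \<beta> \<longrightarrow>
        (\<forall>X\<in>root_space br a n \<alpha>. \<forall>Y\<in>root_space br a n \<beta>. ip X Y = 0)) \<and>
     (\<forall>\<alpha>\<in>roots br a n. nondegenerate_on (root_space br a n \<alpha>) ip)"

definition simple_roots ::
    "('a::real_vector \<Rightarrow> 'a \<Rightarrow> 'a) \<Rightarrow> 'a set \<Rightarrow> 'a set \<Rightarrow> ('a \<Rightarrow> real) set \<Rightarrow> bool" where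
  "simple_roots br a n \<Lambda> \<longleftrightarrow>
     finite \<Lambda> \<and> \<Lambda> \<subseteq> roots br a n \<and> independent \<Lambda> \<and> span \<Lambda> = dual_space a \<and>
     (\<forall>\<alpha>\<in>roots br a n. \<exists>c::('a \<Rightarrow> real) \<Rightarrow> nat. \<alpha> = (\<Sum>\<beta>\<in>\<Lambda>. real (c \<beta>) *\<^sub>R \<beta>))"

definition dual_basis :: "'a set \<Rightarrow> ('a \<Rightarrow> real) set \<Rightarrow> (('a \<Rightarrow> real) \<Rightarrow> 'a) \<Rightarrow> bool" where
  "dual_basis a \<Lambda> B \<longleftrightarrow>
     (\<forall>\<beta>\<in>\<Lambda>. B \<beta> \<in> a) \<and> (\<forall>\<alpha>\<in>\<Lambda>. \<forall>\<beta>\<in>\<Lambda>. \<alpha> (B \<beta>) = (if \<alpha> = \<beta> then 1 else 0))"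

definition attached_roots ::
    "('a::real_vector \<Rightarrow> 'a \<Rightarrow> 'a) \<Rightarrow> 'a set \<Rightarrow> 'a set \<Rightarrow> ('a \<Rightarrow> real) set \<Rightarrow>
     (('a \<Rightarrow> real) \<Rightarrow> 'a) \<Rightarrow> ('a \<Rightarrow> real) set \<Rightarrow> ('a \<Rightarrow> real) set" where
  "attached_roots br a n \<Lambda> B \<Lambda>' = {\<alpha> \<in> roots br a n. \<alpha> (\<Sum>\<beta>\<in>\<Lambda> - \<Lambda>'. B \<beta>) > 0}"

definition attachable ::
    "('a::real_vector \<Rightarrow> 'a \<Rightarrow> 'a) \<Rightarrow> ('a \<Rightarrow> 'a \<Rightarrow> real) \<Rightarrow> 'a set \<Rightarrow> 'a set \<Rightarrow>
     ('a \<Rightarrow> real) set \<Rightarrow> (('a \<Rightarrow> real) \<Rightarrow> 'a) \<Rightarrow> ('a \<Rightarrow> real) set \<Rightarrow> bool" where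
  "attachable br ip a n \<Lambda> B \<Lambda>' \<longleftrightarrow>
     (\<forall>\<beta>\<in>\<Lambda>'.
        bij_betw (dual_reflection ip a \<beta>)
          (attached_roots br a n \<Lambda> B \<Lambda>') (attached_roots br a n \<Lambda> B \<Lambda>') \<and>
        (\<forall>\<alpha>\<in>attached_roots br a n \<Lambda> B \<Lambda>'.
           dim (root_space br a n \<alpha>) = dim (root_space br a n (dual_reflection ip a \<beta> \<alpha>))))"

definition attached_subalgebra ::
    "('a::real_vector \<Rightarrow> 'a \<Rightarrow> 'a) \<Rightarrow> 'a set \<Rightarrow> 'a set \<Rightarrow> ('a \<Rightarrow> real) set \<Rightarrow>
     (('a \<Rightarrow> real) \<Rightarrow> 'a) \<Rightarrow> ('a \<Rightarrow> real) set \<Rightarrow> 'a set" where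
  "attached_subalgebra br a n \<Lambda> B \<Lambda>' =
     span (B ` (\<Lambda> - \<Lambda>') \<union> (\<Union>\<alpha>\<in>attached_roots br a n \<Lambda> B \<Lambda>'. root_space br a n \<alpha>))"

text \<open>
  \<open>U_map br ip g\<close> is the map \<open>U\<close> of the metric Lie algebra carried by the subspace \<open>g\<close>, with
  the restricted bracket and scalar product.
\<close>

definition U_map ::
    "('a::real_vector \<Rightarrow> 'a \<Rightarrow> 'a) \<Rightarrow> ('a \<Rightarrow> 'a \<Rightarrow> real) \<Rightarrow> 'a set \<Rightarrow> 'a \<Rightarrow> 'a \<Rightarrow> 'a" where
  "U_map br ip g X Y =
     (THE u. u \<in> g \<and> (\<forall>W\<in>g. ip u W = (ip (br W X) Y + ip (br W Y) X) / 2))"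

definition second_fundamental_form ::
    "('a::real_vector \<Rightarrow> 'a \<Rightarrow> 'a) \<Rightarrow> ('a \<Rightarrow> 'a \<Rightarrow> real) \<Rightarrow> 'a set \<Rightarrow> 'a \<Rightarrow> 'a \<Rightarrow> 'a" where
  "second_fundamental_form br ip g X Y = U_map br ip UNIV X Y - U_map br ip g X Y"

definition totally_geodesic ::
    "('a::real_vector \<Rightarrow> 'a \<Rightarrow> 'a) \<Rightarrow> ('a \<Rightarrow> 'a \<Rightarrow> real) \<Rightarrow> 'a set \<Rightarrow> bool" where
  "totally_geodesic br ip g \<longleftrightarrow> (\<forall>X\<in>g. \<forall>Y\<in>g. second_fundamental_form br ip g X Y = 0)"

end

theory Submission
  imports Defs
begin

text \<open>
  The subalgebra \<open>s'\<close> is totally geodesic iff \<open>\<langle>[W,X],Y\<rangle> + \<langle>[W,Y],X\<rangle> = 0\<close> for \<open>X, Y \<in> s'\<close> and \<open>W\<close>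
  orthogonal to \<open>s'\<close>. For \<open>W \<in> a\<close> this says that every attached root vanishes on the orthogonal
  complement of \<open>a'\<close> in \<open>a\<close>; applied to \<open>\<beta> \<in> \<Lambda> - \<Lambda>'\<close> it puts the dual vector of \<open>\<beta>\<close> into \<open>a'\<close>, on
  which \<open>\<Lambda>'\<close> vanishes. Conversely, orthogonality and the invariance of the attached roots under
  the reflections in \<open>\<Lambda>'\<close> force every attached root into the span of \<open>\<Lambda> - \<Lambda>'\<close>. So attached roots
  vanish on that complement, and no two of them differ by a root \<open>\<gamma>\<close> with \<open>\<gamma>(Z) = 0\<close>, because such
  a \<open>\<gamma>\<close> lies in the span of \<open>\<Lambda>'\<close>.
\<close>

lemma sum_fun_apply: "(\<Sum>i\<in>I. f i) x = (\<Sum>i\<in>I. f i x)"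
  for f :: "'i \<Rightarrow> 'a \<Rightarrow> 'b::comm_monoid_add"
  by (induction I rule: infinite_finite_induct) simp_all

lemma scaleR_fun_apply: "(c *\<^sub>R f) x = c *\<^sub>R f x" for f :: "'a \<Rightarrow> 'b::real_vector"
  by (simp add: scaleR_fun_def)

lemma functional_combination:
  fixes f :: "'a::real_vector \<Rightarrow> real" and g :: "'i \<Rightarrow> 'a \<Rightarrow> real"
  assumes "finite E" and "subspace V"
    and "\<And>x y. x \<in> V \<Longrightarrow> y \<in> V \<Longrightarrow> f (x + y) = f x + f y"
    and "\<And>x c. x \<in> V \<Longrightarrow> f (c *\<^sub>R x) = c * f x"
    and "\<And>e. e \<in> E \<Longrightarrow> linear (g e)"
    and "\<And>x. x \<in> V \<Longrightarrow> (\<forall>e\<in>E. g e x = 0) \<Longrightarrow> f x = 0"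
  shows "\<exists>c. \<forall>x\<in>V. f x = (\<Sum>e\<in>E. c e * g e x)"
  using assms
proof (induction E arbitrary: V rule: finite_induct)
  case empty
  then show ?case by auto
next
  case (insert e E)
  have lin: "linear (g e')" if "e' \<in> insert e E" for e'
    using insert.prems that by blast
  define V' where "V' = {x\<in>V. g e x = 0}"
  have "subspace V'"
    using insert.prems(1) lin[of e] unfolding V'_def subspace_def
    by (simp add: linear_0 linear_add linear_scale)
  then obtain c where c: "\<And>x. x \<in> V' \<Longrightarrow> f x = (\<Sum>e\<in>E. c e * g e x)"
    using insert.IH[of V'] insert.prems unfolding V'_def by auto
  have upd: "(\<Sum>e'\<in>insert e E. (c(e := d)) e' * g e' x) = d * g e x + (\<Sum>e'\<in>E. c e' * g e' x)"
    for d x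
  proof -
    have "(\<Sum>e'\<in>E. (c(e := d)) e' * g e' x) = (\<Sum>e'\<in>E. c e' * g e' x)"
      using insert.hyps by (intro sum.cong) auto
    then show ?thesis using insert.hyps by simp
  qed
  show ?case
  proof (cases "V' = V")
    case True
    then have "\<forall>x\<in>V. f x = (\<Sum>e'\<in>insert e E. (c(e := 0)) e' * g e' x)"
      using c upd[of 0] by simp
    then show ?thesis by blast
  next
    case False
    then obtain y where y: "y \<in> V" "g e y \<noteq> 0" unfolding V'_def by blast
    define z where "z = (1 / g e y) *\<^sub>R y"
    have z: "z \<in> V" "g e z = 1"
      using y insert.prems(1) lin[of e] by (auto simp: z_def subspace_scale linear_scale)
    define d where "d = f z - (\<Sum>e\<in>E. c e * g e z)"
    have "f x = (\<Sum>e'\<in>insert e E. (c(e := d)) e' * g e' x)" if x: "x \<in> V" for x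
    proof -
      let ?w = "x + (- g e x) *\<^sub>R z"
      have sV: "(- g e x) *\<^sub>R z \<in> V" using z insert.prems(1) subspace_scale by blast
      have lin': "g e' ?w = g e' x - g e x * g e' z" if "e' \<in> insert e E" for e'
        using linear_add[OF lin[OF that], of x "(- g e x) *\<^sub>R z"]
          linear_scale[OF lin[OF that], of "- g e x" z] by simp
      have "?w \<in> V'"
        using x sV insert.prems(1) z lin'[of e] unfolding V'_def
        by (simp only: mem_Collect_eq subspace_add) simp
      then have "f ?w = (\<Sum>e'\<in>E. c e' * g e' ?w)" by (rule c)
      also have "\<dots> = (\<Sum>e'\<in>E. c e' * (g e' x - g e x * g e' z))"
        using lin' by (intro sum.cong) auto
      also have "\<dots> = (\<Sum>e'\<in>E. c e' * g e' x) - g e x * (\<Sum>e'\<in>E. c e' * g e' z)"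
        by (simp add: right_diff_distrib sum_subtractf sum_distrib_left mult.left_commute)
      finally have "f ?w = (\<Sum>e'\<in>E. c e' * g e' x) - g e x * (\<Sum>e'\<in>E. c e' * g e' z)" .
      moreover have "f ?w = f x + (- g e x) * f z"
        using insert.prems(2)[OF x sV] insert.prems(3)[OF z(1)] by metis
      ultimately show ?thesis unfolding upd d_def by (simp add: algebra_simps)
    qed
    then show ?thesis by blast
  qed
qed

locale finite_dim_form =
  fixes ip :: "'a::real_vector \<Rightarrow> 'a \<Rightarrow> real"
  assumes finite_dim: "\<exists>S::'a set. finite S \<and> span S = UNIV"
    and bil_ip: "bilinear ip"
    and ip_commute: "ip X Y = ip Y X"
begin

lemma linear_ip [simp]: "linear (ip X)"
  using bil_ip by (simp add: bilinear_def)

lemmas ip_simps = bilinear_ladd[OF bil_ip] bilinear_radd[OF bil_ip]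
  bilinear_lmul[OF bil_ip] bilinear_rmul[OF bil_ip] bilinear_lzero[OF bil_ip]
  bilinear_rzero[OF bil_ip] bilinear_lsub[OF bil_ip] bilinear_rsub[OF bil_ip]

lemma ip_sum_left: "ip (\<Sum>i\<in>I. f i) Y = (\<Sum>i\<in>I. ip (f i) Y)"
  using linear_sum[OF linear_ip, of Y f I] by (simp add: ip_commute)

lemma independent_finite: "independent (S::'a set) \<Longrightarrow> finite S"
  using finite_dim independent_span_bound by blast

lemma representation:
  assumes "subspace V" "nondegenerate_on V ip"
    and "\<And>x y. x \<in> V \<Longrightarrow> y \<in> V \<Longrightarrow> f (x + y) = f x + f y"
    and "\<And>x c. x \<in> V \<Longrightarrow> f (c *\<^sub>R x) = c * f x"
  shows "\<exists>!u. u \<in> V \<and> (\<forall>x\<in>V. ip u x = f x)"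
proof -
  obtain E where E: "E \<subseteq> V" "independent E" "V \<subseteq> span E"
    using maximal_independent_subset by blast
  have "finite E" using E independent_finite by blast
  moreover have "f x = 0" if x: "x \<in> V" "\<forall>e\<in>E. ip e x = 0" for x
  proof -
    have "ip x y = 0" if "y \<in> V" for y
      using linear_eq_0_on_span[OF linear_ip, of E x y] that E x ip_commute by auto
    then have "x = 0" using assms(2) x unfolding nondegenerate_on_def by blast
    then show ?thesis using assms(4)[of x 0] x by simp
  qed
  ultimately obtain c where c: "\<forall>x\<in>V. f x = (\<Sum>e\<in>E. c e * ip e x)"
    using functional_combination[of E V f ip] assms by auto
  let ?u = "\<Sum>e\<in>E. c e *\<^sub>R e"
  have "?u \<in> V"
    using assms(1) E by (intro subspace_sum) (auto intro: subspace_scale)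
  moreover have "\<forall>x\<in>V. ip ?u x = f x"
    using c by (simp add: ip_sum_left ip_simps)
  moreover have "u = v"
    if "u \<in> V" "v \<in> V" "\<forall>x\<in>V. ip u x = f x" "\<forall>x\<in>V. ip v x = f x" for u v
  proof -
    have "u - v \<in> V" using that assms(1) subspace_diff by blast
    moreover have "\<forall>x\<in>V. ip (u - v) x = 0" using that by (simp add: ip_simps)
    ultimately show ?thesis using assms(2) unfolding nondegenerate_on_def by fastforce
  qed
  ultimately show ?thesis by blast
qed

lemma nondegenerate_on_pos_def:
  assumes "\<And>X. X \<in> V \<Longrightarrow> X \<noteq> 0 \<Longrightarrow> ip X X > 0"
  shows "nondegenerate_on V ip"
  using assms unfolding nondegenerate_on_def by fastforce

text \<open>The map \<open>U\<close> of \<open>span G\<close> is the orthogonal projection of the ambient one, so only the pairing of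
  the ambient \<open>U\<close> with the orthogonal complement \<open>span M\<close> has to vanish.\<close>

lemma totally_geodesic_iff:
  assumes br: "bilinear br" and nd: "nondegenerate_on UNIV ip"
    and orth: "\<And>X Y. X \<in> G \<Longrightarrow> Y \<in> M \<Longrightarrow> ip X Y = 0"
    and UNIV: "span (G \<union> M) = UNIV"
  shows "totally_geodesic br ip (span G) \<longleftrightarrow>
    (\<forall>X\<in>G. \<forall>Y\<in>G. \<forall>W\<in>M. ip (br W X) Y + ip (br W Y) X = 0)"
proof -
  let ?g = "span G"
  define q where "q X Y W = (ip (br W X) Y + ip (br W Y) X) / 2" for X Y W
  note bs = bilinear_ladd[OF br] bilinear_radd[OF br] bilinear_lmul[OF br] bilinear_rmul[OF br]
  have qlin: "linear (q X Y)" "linear (\<lambda>X. q X Y W)" "linear (\<lambda>Y. q X Y W)" for X Y W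
    by (rule linearI; simp add: q_def ip_simps bs field_simps)+
  have orth': "ip X Y = 0" if "X \<in> ?g" "Y \<in> M" for X Y
    using linear_eq_0_on_span[OF linear_ip, of G Y X] orth that by (simp add: ip_commute)
  have ndg: "nondegenerate_on ?g ip"
  proof -
    have "X = 0" if X: "X \<in> ?g" "\<forall>Y\<in>?g. ip X Y = 0" for X
    proof -
      have "ip X Y = 0" for Y
        using linear_eq_0_on_span[OF linear_ip, of "G \<union> M" X Y] orth' X UNIV span_base[of _ G]
        by blast
      then show ?thesis using nd unfolding nondegenerate_on_def by blast
    qed
    then show ?thesis unfolding nondegenerate_on_def by blast
  qed
  have U: "U_map br ip V X Y \<in> V \<and> (\<forall>W\<in>V. ip (U_map br ip V X Y) W = q X Y W)"
    if "subspace V" "nondegenerate_on V ip" for V X Y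
  proof -
    have "\<exists>!u. u \<in> V \<and> (\<forall>W\<in>V. ip u W = q X Y W)"
      using that qlin(1)[of X Y] by (intro representation) (simp_all add: linear_add linear_scale)
    from theI'[OF this] show ?thesis unfolding U_map_def q_def .
  qed
  note Ug = U[OF subspace_span ndg] and UU = U[OF subspace_UNIV nd]
  have pointwise: "U_map br ip UNIV X Y = U_map br ip ?g X Y \<longleftrightarrow> (\<forall>W\<in>M. q X Y W = 0)" for X Y
  proof
    assume "U_map br ip UNIV X Y = U_map br ip ?g X Y"
    then show "\<forall>W\<in>M. q X Y W = 0" using Ug[of X Y] UU[of X Y] orth' by (metis UNIV_I)
  next
    assume M: "\<forall>W\<in>M. q X Y W = 0"
    let ?d = "U_map br ip UNIV X Y - U_map br ip ?g X Y"
    have "ip ?d W = 0" if "W \<in> G \<union> M" for W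
      using that M Ug[of X Y] UU[of X Y] orth' by (auto simp: ip_simps span_base)
    then have "ip ?d W = 0" for W
      using linear_eq_0_on_span[OF linear_ip, of "G \<union> M" ?d W] UNIV by blast
    then show "U_map br ip UNIV X Y = U_map br ip ?g X Y"
      using nd unfolding nondegenerate_on_def by fastforce
  qed
  have "totally_geodesic br ip ?g \<longleftrightarrow> (\<forall>X\<in>?g. \<forall>Y\<in>?g. \<forall>W\<in>M. q X Y W = 0)"
    unfolding totally_geodesic_def second_fundamental_form_def using pointwise by simp
  also have "\<dots> \<longleftrightarrow> (\<forall>X\<in>G. \<forall>Y\<in>G. \<forall>W\<in>M. q X Y W = 0)"
  proof
    assume *: "\<forall>X\<in>G. \<forall>Y\<in>G. \<forall>W\<in>M. q X Y W = 0"
    have "q X Y W = 0" if "X \<in> G" "Y \<in> ?g" "W \<in> M" for X Y W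
      using linear_eq_0_on_span[OF qlin(3), of G X W Y] * that by blast
    then show "\<forall>X\<in>?g. \<forall>Y\<in>?g. \<forall>W\<in>M. q X Y W = 0"
      using linear_eq_0_on_span[OF qlin(2), of G] by blast
  qed (blast intro: span_base)
  finally show ?thesis by (simp add: q_def)
qed

end

locale attached_setup =
  fixes br :: "'a::real_vector \<Rightarrow> 'a \<Rightarrow> 'a" and ip :: "'a \<Rightarrow> 'a \<Rightarrow> real"
    and a n :: "'a set" and \<Lambda> \<Lambda>' :: "('a \<Rightarrow> real) set" and B :: "('a \<Rightarrow> real) \<Rightarrow> 'a"
  assumes iwasawa: "strong_iwasawa br ip a n"
    and decomposition: "root_decomposition br ip a n"
    and simple: "simple_roots br a n \<Lambda>"
    and dual: "dual_basis a \<Lambda> B"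
    and subset: "\<Lambda>' \<subset> \<Lambda>"
    and attachable: "attachable br ip a n \<Lambda> B \<Lambda>'"
begin

sublocale finite_dim_form ip
  using iwasawa by unfold_locales (auto simp: strong_iwasawa_def metric_lie_algebra_def)

abbreviation "R \<equiv> roots br a n"
abbreviation "rs \<equiv> root_space br a n"
abbreviation "H \<equiv> dual_vector ip a"
abbreviation "att \<equiv> attached_roots br a n \<Lambda> B \<Lambda>'"

lemma iwasawa_conjuncts:
  shows metric: "metric_lie_algebra br ip"
    and n_eq: "n = bracket_space br UNIV UNIV"
    and a_eq: "a = orth_complement ip n"
    and a_n_span: "span (a \<union> n) = UNIV"
    and a_abelian_all: "\<forall>A\<in>a. \<forall>A'\<in>a. br A A' = 0"
    and regular: "\<exists>A0\<in>a. \<forall>z. complex_eigenvalue_on n (br A0) z \<longrightarrow> Im z = 0 \<and> Re z > 0"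
    and a_pos_all: "\<forall>A\<in>a. A \<noteq> 0 \<longrightarrow> ip A A > 0"
  using iwasawa unfolding strong_iwasawa_def by - (elim conjE, assumption)+

lemma nondegenerate: "nondegenerate_on UNIV ip" and lie: "lie_bracket br"
  using metric unfolding metric_lie_algebra_def by - (elim conjE, assumption)+

lemma a_abelian: "A \<in> a \<Longrightarrow> A' \<in> a \<Longrightarrow> br A A' = 0"
  using a_abelian_all by blast

lemma a_pos: "A \<in> a \<Longrightarrow> A \<noteq> 0 \<Longrightarrow> ip A A > 0"
  using a_pos_all by blast

lemma bil_br: "bilinear br"
  and br_self: "br X X = 0"
  and jacobi: "br X (br Y Z) + br Y (br Z X) + br Z (br X Y) = 0"
  using lie unfolding lie_bracket_def by blast+

lemmas br_simps = bilinear_ladd[OF bil_br] bilinear_radd[OF bil_br]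
  bilinear_lmul[OF bil_br] bilinear_rmul[OF bil_br] bilinear_lzero[OF bil_br]
  bilinear_rzero[OF bil_br]

lemma br_anticommute: "br X Y = - br Y X"
  using br_self[of "X + Y"] br_self[of X] br_self[of Y] by (simp add: br_simps eq_neg_iff_add_eq_0 add.commute)

lemma br_in_n: "br X Y \<in> n"
  unfolding n_eq bracket_space_def by (rule span_base) blast

lemma subspace_n: "subspace n"
  unfolding n_eq bracket_space_def by simp

lemma subspace_a: "subspace a"
  unfolding a_eq orth_complement_def subspace_def by (simp add: ip_simps)

lemma ip_a_n: "A \<in> a \<Longrightarrow> X \<in> n \<Longrightarrow> ip A X = 0" "A \<in> a \<Longrightarrow> X \<in> n \<Longrightarrow> ip X A = 0"
  unfolding a_eq orth_complement_def by (auto simp: ip_commute)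

lemma rs_subset_n: "X \<in> rs \<alpha> \<Longrightarrow> X \<in> n"
  and br_a_rs: "X \<in> rs \<alpha> \<Longrightarrow> A \<in> a \<Longrightarrow> br A X = \<alpha> A *\<^sub>R X"
  unfolding root_space_def by auto

lemma subspace_rs: "subspace (rs \<alpha>)"
  using subspace_n unfolding root_space_def subspace_def
  by (simp add: br_simps scaleR_add_right)

lemma R_dual_space: "\<alpha> \<in> R \<Longrightarrow> \<alpha> \<in> dual_space a"
  unfolding roots_def by blast

lemma direct_sum: "internal_direct_sum R rs n"
  using decomposition by (simp add: root_decomposition_def)

lemma rs_orth: "\<alpha> \<in> R \<Longrightarrow> \<beta> \<in> R \<Longrightarrow> \<alpha> \<noteq> \<beta> \<Longrightarrow> X \<in> rs \<alpha> \<Longrightarrow> Y \<in> rs \<beta> \<Longrightarrow> ip X Y = 0"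
  using decomposition unfolding root_decomposition_def by blast

lemma rs_nonzero: "\<alpha> \<in> R \<Longrightarrow> \<exists>X\<in>rs \<alpha>. X \<noteq> 0"
proof -
  assume "\<alpha> \<in> R"
  then have "rs \<alpha> \<noteq> {0}" by (simp add: roots_def)
  moreover have "0 \<in> rs \<alpha>" using subspace_rs subspace_0 by blast
  ultimately show ?thesis by blast
qed

lemma finite_R: "finite R"
proof -
  obtain x where x: "\<And>\<alpha>. \<alpha> \<in> R \<Longrightarrow> x \<alpha> \<in> rs \<alpha> \<and> x \<alpha> \<noteq> 0"
    using rs_nonzero by metis
  have ds: "\<forall>i\<in>F. y i = 0"
    if "finite F" "F \<subseteq> R" "\<forall>i\<in>F. y i \<in> rs i" "(\<Sum>i\<in>F. y i) = 0" for F y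
    using conjunct2[OF direct_sum[unfolded internal_direct_sum_def], rule_format, of F y] that
    by simp
  have inj: "inj_on x R"
  proof (rule inj_onI, rule ccontr)
    fix \<alpha> \<beta> assume *: "\<alpha> \<in> R" "\<beta> \<in> R" "x \<alpha> = x \<beta>" "\<alpha> \<noteq> \<beta>"
    define y where "y = x(\<beta> := - x \<beta>)"
    have xx: "x \<alpha> \<in> rs \<alpha>" "x \<alpha> \<noteq> 0" "- x \<beta> \<in> rs \<beta>"
      using x[OF *(1)] x[OF *(2)] subspace_neg[OF subspace_rs] by simp_all
    have "\<forall>i\<in>{\<alpha>,\<beta>}. y i = 0"
      using xx * by (intro ds) (simp_all add: y_def)
    then show False using xx(2) *(4) by (simp add: y_def)
  qed
  have "independent (x ` R)"
    unfolding independent_explicit_module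
  proof (intro allI impI)
    fix t u v assume t: "finite t" "t \<subseteq> x ` R" "(\<Sum>v\<in>t. u v *\<^sub>R v) = 0" "v \<in> t"
    obtain F where F: "F \<subseteq> R" "t = x ` F" using t(2) by (meson subset_imageE)
    have "inj_on x F" using inj F inj_on_subset by blast
    then have fF: "finite F" and s: "(\<Sum>i\<in>F. u (x i) *\<^sub>R x i) = 0"
      using t F by (auto simp: finite_image_iff sum.reindex)
    have "\<forall>i\<in>F. u (x i) *\<^sub>R x i \<in> rs i" using F(1) x subspace_scale[OF subspace_rs] by blast
    from ds[OF fF F(1) this s] have "\<forall>i\<in>F. u (x i) *\<^sub>R x i = 0" .
    moreover obtain i where i: "i \<in> F" "v = x i" using F(2) t(4) by blast
    ultimately have "u v *\<^sub>R v = 0" by simp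
    moreover have "v \<noteq> 0" using x[OF subsetD[OF F(1) i(1)]] i(2) by simp
    ultimately show "u v = 0" by simp
  qed
  then have "finite (x ` R)" by (rule independent_finite)
  then show ?thesis using inj by (simp add: finite_image_iff)
qed

lemma zero_not_root: assumes "\<alpha> \<in> R" shows "\<exists>A\<in>a. \<alpha> A \<noteq> 0"
proof (rule ccontr)
  assume *: "\<not> ?thesis"
  obtain X where X: "X \<in> rs \<alpha>" "X \<noteq> 0" using rs_nonzero assms by blast
  obtain A0 where A0: "A0 \<in> a" "\<And>z. complex_eigenvalue_on n (br A0) z \<Longrightarrow> Re z > 0"
    using regular by blast
  have "complex_eigenvalue_on n (br A0) 0"
    unfolding complex_eigenvalue_on_def
    using X A0(1) * br_a_rs rs_subset_n subspace_0[OF subspace_n]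
    by (intro bexI[of _ X] bexI[of _ 0]) (auto simp: br_simps)
  then show False using A0(2)[of 0] by simp
qed

lemma nondegenerate_a: "nondegenerate_on a ip"
  using a_pos by (rule nondegenerate_on_pos_def)

lemma dual_add: "\<alpha> \<in> dual_space a \<Longrightarrow> X \<in> a \<Longrightarrow> Y \<in> a \<Longrightarrow> \<alpha> (X + Y) = \<alpha> X + \<alpha> Y"
  and dual_scale: "\<alpha> \<in> dual_space a \<Longrightarrow> X \<in> a \<Longrightarrow> \<alpha> (c *\<^sub>R X) = c * \<alpha> X"
  unfolding dual_space_def by auto

lemma H: assumes "\<alpha> \<in> dual_space a"
  shows "H \<alpha> \<in> a" "X \<in> a \<Longrightarrow> ip (H \<alpha>) X = \<alpha> X"
proof -
  have "\<exists>!u. u \<in> a \<and> (\<forall>x\<in>a. ip u x = \<alpha> x)"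
    using assms subspace_a nondegenerate_a dual_add dual_scale by (intro representation) auto
  from theI'[OF this] show "H \<alpha> \<in> a" "X \<in> a \<Longrightarrow> ip (H \<alpha>) X = \<alpha> X"
    unfolding dual_vector_def by blast+
qed

lemma dual_ip_eq:
  "\<alpha> \<in> dual_space a \<Longrightarrow> \<beta> \<in> dual_space a \<Longrightarrow> dual_ip ip a \<alpha> \<beta> = \<alpha> (H \<beta>)"
  unfolding dual_ip_def using H by simp

lemma \<Lambda>_finite: "finite \<Lambda>"
  and \<Lambda>_R: "\<beta> \<in> \<Lambda> \<Longrightarrow> \<beta> \<in> R"
  and \<Lambda>_span: "span \<Lambda> = dual_space a"
  and \<Lambda>_combination: "\<alpha> \<in> R \<Longrightarrow> \<exists>c::('a \<Rightarrow> real) \<Rightarrow> nat. \<alpha> = (\<Sum>\<beta>\<in>\<Lambda>. real (c \<beta>) *\<^sub>R \<beta>)"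
  using simple unfolding simple_roots_def by blast+

lemma \<Lambda>_dual: "\<beta> \<in> \<Lambda> \<Longrightarrow> \<beta> \<in> dual_space a"
  using \<Lambda>_R R_dual_space by blast

lemma B_a: "\<beta> \<in> \<Lambda> \<Longrightarrow> B \<beta> \<in> a"
  and \<Lambda>_B: "\<alpha> \<in> \<Lambda> \<Longrightarrow> \<beta> \<in> \<Lambda> \<Longrightarrow> \<alpha> (B \<beta>) = (if \<alpha> = \<beta> then 1 else 0)"
  using dual unfolding dual_basis_def by blast+

lemma sum_B_a: "S \<subseteq> \<Lambda> \<Longrightarrow> (\<Sum>\<beta>\<in>S. c \<beta> *\<^sub>R B \<beta>) \<in> a"
  using subspace_a B_a by (intro subspace_sum) (auto intro: subspace_scale)

lemma dual_sum_B:
  assumes "\<alpha> \<in> dual_space a" "S \<subseteq> \<Lambda>"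
  shows "\<alpha> (\<Sum>\<beta>\<in>S. c \<beta> *\<^sub>R B \<beta>) = (\<Sum>\<beta>\<in>S. c \<beta> * \<alpha> (B \<beta>))"
proof -
  have "\<alpha> (\<Sum>\<beta>\<in>S. c \<beta> *\<^sub>R B \<beta>) = ip (H \<alpha>) (\<Sum>\<beta>\<in>S. c \<beta> *\<^sub>R B \<beta>)"
    using H assms sum_B_a by simp
  also have "\<dots> = (\<Sum>\<beta>\<in>S. c \<beta> * ip (H \<alpha>) (B \<beta>))"
    by (simp add: linear_sum[OF linear_ip] ip_simps)
  also have "\<dots> = (\<Sum>\<beta>\<in>S. c \<beta> * \<alpha> (B \<beta>))"
    using H(2)[OF assms(1)] B_a assms(2) by (intro sum.cong) auto
  finally show ?thesis .
qed

lemma a_expansion: assumes "X \<in> a" shows "X = (\<Sum>\<beta>\<in>\<Lambda>. \<beta> X *\<^sub>R B \<beta>)"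
proof -
  define D where "D = X - (\<Sum>\<beta>\<in>\<Lambda>. \<beta> X *\<^sub>R B \<beta>)"
  have Da: "D \<in> a" unfolding D_def
    by (rule subspace_diff[OF subspace_a assms sum_B_a[OF order_refl]])
  have "\<beta> D = 0" if \<beta>: "\<beta> \<in> \<Lambda>" for \<beta>
  proof -
    have "\<beta> D = ip (H \<beta>) D" using H(2)[OF \<Lambda>_dual[OF \<beta>] Da] by simp
    also have "\<dots> = \<beta> X - \<beta> (\<Sum>\<gamma>\<in>\<Lambda>. \<gamma> X *\<^sub>R B \<gamma>)"
      using H \<Lambda>_dual \<beta> assms sum_B_a[of \<Lambda>] by (simp add: D_def ip_simps)
    also have "\<dots> = 0"
    proof -
      have "(\<Sum>\<gamma>\<in>\<Lambda>. \<gamma> X * \<beta> (B \<gamma>)) = (\<Sum>\<gamma>\<in>\<Lambda>. if \<beta> = \<gamma> then \<beta> X else 0)"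
        using \<beta> by (intro sum.cong) (auto simp: \<Lambda>_B)
      then show ?thesis using dual_sum_B[OF \<Lambda>_dual[OF \<beta>], of \<Lambda>] \<beta> \<Lambda>_finite by simp
    qed
    finally show ?thesis .
  qed
  moreover have "linear (\<lambda>f::'a \<Rightarrow> real. f D)"
    by (rule linearI) (simp_all add: scaleR_fun_apply)
  ultimately have vanish: "f D = 0" if "f \<in> dual_space a" for f
    using linear_eq_0_on_span[of "\<lambda>f. f D" \<Lambda> f] that \<Lambda>_span by blast
  have "(\<lambda>Y. if Y \<in> a then ip D Y else 0) \<in> dual_space a"
    unfolding dual_space_def
    using subspace_a by (auto simp: ip_simps subspace_add subspace_scale)
  from vanish[OF this] have "ip D D = 0" using Da by simp
  then have "D = 0" using a_pos Da by fastforce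
  then show ?thesis unfolding D_def by simp
qed

lemma dual_expansion:
  assumes "\<alpha> \<in> dual_space a" "X \<in> a"
  shows "\<alpha> X = (\<Sum>\<beta>\<in>\<Lambda>. \<alpha> (B \<beta>) * \<beta> X)"
  using dual_sum_B[OF assms(1), of \<Lambda> "\<lambda>\<beta>. \<beta> X"] a_expansion[OF assms(2)]
  by (simp add: mult.commute)

lemma root_coefficient_nonneg: assumes "\<alpha> \<in> R" "\<beta> \<in> \<Lambda>" shows "\<alpha> (B \<beta>) \<ge> 0"
proof -
  obtain c :: "('a \<Rightarrow> real) \<Rightarrow> nat" where c: "\<alpha> = (\<Sum>\<beta>\<in>\<Lambda>. real (c \<beta>) *\<^sub>R \<beta>)"
    using \<Lambda>_combination[OF assms(1)] by blast
  have "\<alpha> (B \<beta>) = (\<Sum>\<gamma>\<in>\<Lambda>. real (c \<gamma>) * \<gamma> (B \<beta>))"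
    by (subst c) (simp add: sum_fun_apply scaleR_fun_apply)
  also have "\<dots> \<ge> 0" using assms(2) by (intro sum_nonneg) (auto simp: \<Lambda>_B)
  finally show ?thesis .
qed

lemma root_Z: assumes "\<alpha> \<in> R"
  shows "\<alpha> (\<Sum>\<beta>\<in>\<Lambda> - \<Lambda>'. B \<beta>) = (\<Sum>\<beta>\<in>\<Lambda> - \<Lambda>'. \<alpha> (B \<beta>))"
  using dual_sum_B[OF R_dual_space[OF assms], of "\<Lambda> - \<Lambda>'" "\<lambda>_. 1"] by simp

lemma unattached_coefficient:
  assumes "\<gamma> \<in> R - att" "\<beta> \<in> \<Lambda> - \<Lambda>'" shows "\<gamma> (B \<beta>) = 0"
proof -
  have nonneg: "\<gamma> (B \<delta>) \<ge> 0" if "\<delta> \<in> \<Lambda> - \<Lambda>'" for \<delta>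
    using root_coefficient_nonneg[of \<gamma> \<delta>] assms(1) that by simp
  have "(\<Sum>\<beta>\<in>\<Lambda> - \<Lambda>'. \<gamma> (B \<beta>)) \<le> 0"
    using assms(1) root_Z[of \<gamma>] by (auto simp: attached_roots_def not_less)
  moreover from nonneg have "(\<Sum>\<beta>\<in>\<Lambda> - \<Lambda>'. \<gamma> (B \<beta>)) \<ge> 0" by (rule sum_nonneg)
  ultimately have "(\<Sum>\<beta>\<in>\<Lambda> - \<Lambda>'. \<gamma> (B \<beta>)) = 0" by linarith
  from sum_nonneg_0[OF finite_Diff[OF \<Lambda>_finite] nonneg this assms(2)] show ?thesis .
qed

lemma att_R: "\<alpha> \<in> att \<Longrightarrow> \<alpha> \<in> R"
  by (simp add: attached_roots_def)

lemma simple_attached: assumes "\<beta> \<in> \<Lambda> - \<Lambda>'" shows "\<beta> \<in> att"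
proof (rule ccontr)
  assume "\<beta> \<notin> att"
  then have "\<beta> (B \<beta>) = 0" using unattached_coefficient[of \<beta> \<beta>] assms \<Lambda>_R[of \<beta>] by simp
  then show False using \<Lambda>_B[of \<beta> \<beta>] assms by simp
qed

lemma rs_bracket:
  assumes "W \<in> rs \<gamma>" "X \<in> rs \<alpha>" shows "br W X \<in> rs (\<gamma> + \<alpha>)"
proof -
  have "br A (br W X) = (\<gamma> + \<alpha>) A *\<^sub>R br W X" if A: "A \<in> a" for A
  proof -
    have "br W (br X A) = - \<alpha> A *\<^sub>R br W X"
      using br_a_rs[OF assms(2) A] br_anticommute[of X A] bilinear_rneg[OF bil_br]
      by (simp add: br_simps)
    moreover have "br X (br A W) = - \<gamma> A *\<^sub>R br W X"
      using br_a_rs[OF assms(1) A] br_anticommute[of X W] by (simp add: br_simps)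
    ultimately show ?thesis
      using jacobi[of A W X] by (simp add: algebra_simps)
  qed
  then show ?thesis by (simp add: root_space_def br_in_n)
qed

lemma dual_space_add: "\<alpha> \<in> dual_space a \<Longrightarrow> \<beta> \<in> dual_space a \<Longrightarrow> \<alpha> + \<beta> \<in> dual_space a"
  unfolding dual_space_def by (auto simp: algebra_simps)

text \<open>The sum of the attached roots is fixed by every reflection in \<open>\<Lambda>'\<close>, so it is orthogonal
  to \<open>\<Lambda>'\<close>; as all its coefficients are nonnegative, those along \<open>\<Lambda>'\<close> vanish for each
  attached root separately.\<close>

lemma attached_coefficient:
  assumes orth: "\<forall>\<alpha>\<in>\<Lambda>'. \<forall>\<beta>\<in>\<Lambda> - \<Lambda>'. dual_ip ip a \<alpha> \<beta> = 0"
    and \<alpha>: "\<alpha> \<in> att" and \<beta>: "\<beta> \<in> \<Lambda>'"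
  shows "\<alpha> (B \<beta>) = 0"
proof -
  have fatt: "finite att" using finite_R by (simp add: attached_roots_def)
  have fL': "finite \<Lambda>'" using \<Lambda>_finite subset finite_subset by blast
  have L': "\<delta> \<in> \<Lambda>" if "\<delta> \<in> \<Lambda>'" for \<delta> using that subset by blast
  define C where "C \<delta> = (\<Sum>\<alpha>\<in>att. \<alpha> (B \<delta>))" for \<delta>
  define v where "v = (\<Sum>\<delta>\<in>\<Lambda>'. C \<delta> *\<^sub>R H \<delta>)"
  have va: "v \<in> a" unfolding v_def
    by (intro subspace_sum subspace_scale subspace_a H(1) \<Lambda>_dual L')
  have ipv: "ip v X = (\<Sum>\<delta>\<in>\<Lambda>'. C \<delta> * \<delta> X)" if "X \<in> a" for X
    unfolding v_def ip_sum_left ip_simps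
    using H(2)[OF \<Lambda>_dual[OF L'] that] by (intro sum.cong) simp_all
  have "ip v (H \<epsilon>) = 0" if \<epsilon>: "\<epsilon> \<in> \<Lambda>'" for \<epsilon>
  proof -
    have \<epsilon>d: "\<epsilon> \<in> dual_space a" using \<epsilon> L' \<Lambda>_dual by blast
    define k where "k \<alpha> = 2 * dual_ip ip a \<alpha> \<epsilon> / dual_ip ip a \<epsilon> \<epsilon>" for \<alpha>
    have bij: "bij_betw (dual_reflection ip a \<epsilon>) att att"
      using attachable \<epsilon> unfolding attachable_def by blast
    have "(\<Sum>\<alpha>\<in>att. dual_reflection ip a \<epsilon> \<alpha> (B \<epsilon>)) = (\<Sum>\<alpha>\<in>att. \<alpha> (B \<epsilon>))"
      using sum.reindex_bij_betw[OF bij, of "\<lambda>\<alpha>. \<alpha> (B \<epsilon>)"] .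
    moreover have "dual_reflection ip a \<epsilon> \<alpha> (B \<epsilon>) = \<alpha> (B \<epsilon>) - k \<alpha>" for \<alpha>
      using \<Lambda>_B[of \<epsilon> \<epsilon>] \<epsilon> L' by (simp add: dual_reflection_def k_def scaleR_fun_apply)
    ultimately have "(\<Sum>\<alpha>\<in>att. k \<alpha>) = 0" by (simp add: sum_subtractf)
    then have "2 * (\<Sum>\<alpha>\<in>att. dual_ip ip a \<alpha> \<epsilon>) / dual_ip ip a \<epsilon> \<epsilon> = 0"
      by (simp add: k_def sum_divide_distrib sum_distrib_left)
    moreover have "dual_ip ip a \<epsilon> \<epsilon> \<noteq> 0"
    proof
      assume "dual_ip ip a \<epsilon> \<epsilon> = 0"
      then have "H \<epsilon> = 0" using a_pos H(1)[OF \<epsilon>d] unfolding dual_ip_def by fastforce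
      then have "\<epsilon> (B \<epsilon>) = 0" using H(2)[OF \<epsilon>d B_a[OF L'[OF \<epsilon>]]] by (simp add: ip_simps)
      then show False using \<Lambda>_B[of \<epsilon> \<epsilon>] \<epsilon> L' by simp
    qed
    ultimately have "0 = (\<Sum>\<alpha>\<in>att. dual_ip ip a \<alpha> \<epsilon>)" by simp
    also have "\<dots> = (\<Sum>\<alpha>\<in>att. \<Sum>\<delta>\<in>\<Lambda>. \<alpha> (B \<delta>) * \<delta> (H \<epsilon>))"
    proof (rule sum.cong[OF refl])
      fix \<alpha> assume "\<alpha> \<in> att"
      then have d: "\<alpha> \<in> dual_space a" by (intro R_dual_space att_R)
      show "dual_ip ip a \<alpha> \<epsilon> = (\<Sum>\<delta>\<in>\<Lambda>. \<alpha> (B \<delta>) * \<delta> (H \<epsilon>))"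
        unfolding dual_ip_eq[OF d \<epsilon>d] by (rule dual_expansion[OF d H(1)[OF \<epsilon>d]])
    qed
    also have "\<dots> = (\<Sum>\<delta>\<in>\<Lambda>. C \<delta> * \<delta> (H \<epsilon>))"
      unfolding C_def by (subst sum.swap) (simp add: sum_distrib_right)
    also have "\<dots> = (\<Sum>\<delta>\<in>\<Lambda>'. C \<delta> * \<delta> (H \<epsilon>))"
    proof (rule sum.mono_neutral_right)
      show "\<forall>\<delta>\<in>\<Lambda> - \<Lambda>'. C \<delta> * \<delta> (H \<epsilon>) = 0"
      proof
        fix \<delta> assume \<delta>: "\<delta> \<in> \<Lambda> - \<Lambda>'"
        then have "\<delta> \<in> dual_space a" by (simp add: \<Lambda>_dual)
        then have "\<delta> (H \<epsilon>) = dual_ip ip a \<delta> \<epsilon>" using dual_ip_eq \<epsilon>d by simp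
        also have "\<dots> = dual_ip ip a \<epsilon> \<delta>" by (simp add: dual_ip_def ip_commute)
        finally show "C \<delta> * \<delta> (H \<epsilon>) = 0" using orth \<epsilon> \<delta> by simp
      qed
    qed (use \<Lambda>_finite subset in auto)
    also have "\<dots> = ip v (H \<epsilon>)" using ipv[OF H(1)[OF \<epsilon>d]] by simp
    finally show ?thesis by simp
  qed
  then have "(\<Sum>\<delta>\<in>\<Lambda>'. C \<delta> * ip v (H \<delta>)) = 0" by simp
  then have "ip v v = 0"
    by (subst (2) v_def) (simp add: linear_sum[OF linear_ip] ip_simps)
  then have "v = 0" using a_pos va by fastforce
  then have "0 = (\<Sum>\<delta>\<in>\<Lambda>'. C \<delta> * \<delta> (B \<beta>))"
    using ipv[OF B_a[OF L'[OF \<beta>]]] by (simp add: ip_simps)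
  also have "\<dots> = (\<Sum>\<delta>\<in>\<Lambda>'. if \<delta> = \<beta> then C \<beta> else 0)"
    using \<beta> L' by (intro sum.cong) (auto simp: \<Lambda>_B)
  also have "\<dots> = C \<beta>" using fL' \<beta> by simp
  finally have "(\<Sum>\<alpha>\<in>att. \<alpha> (B \<beta>)) = 0" by (simp add: C_def)
  moreover have "\<gamma> (B \<beta>) \<ge> 0" if "\<gamma> \<in> att" for \<gamma>
    by (rule root_coefficient_nonneg[OF att_R[OF that] L'[OF \<beta>]])
  ultimately show ?thesis
    using sum_nonneg_0[OF fatt, of "\<lambda>\<alpha>. \<alpha> (B \<beta>)" \<alpha>] \<alpha> by blast
qed

definition "a_perp = {A\<in>a. \<forall>\<beta>\<in>\<Lambda> - \<Lambda>'. ip A (B \<beta>) = 0}"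
definition "gens = B ` (\<Lambda> - \<Lambda>') \<union> (\<Union>\<alpha>\<in>att. rs \<alpha>)"
definition "perp_gens = a_perp \<union> (\<Union>\<gamma>\<in>R - att. rs \<gamma>)"

lemma a_splitting:
  assumes "X \<in> a"
  obtains P Q where "X = P + Q" "P \<in> span (B ` (\<Lambda> - \<Lambda>'))" "P \<in> a" "Q \<in> a_perp"
proof -
  let ?V = "span (B ` (\<Lambda> - \<Lambda>'))"
  have Va: "?V \<subseteq> a" using B_a subspace_a by (intro span_minimal) auto
  then have "nondegenerate_on ?V ip" using a_pos by (intro nondegenerate_on_pos_def) auto
  then obtain P where P: "P \<in> ?V" "\<forall>Y\<in>?V. ip P Y = ip X Y"
    using representation[of ?V "ip X"] by (auto simp: ip_simps)
  moreover have "X - P \<in> a"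
    using P(1) Va subspace_diff[OF subspace_a assms, of P] by auto
  ultimately have "X - P \<in> a_perp"
    by (auto simp: a_perp_def ip_simps span_base)
  then show thesis using that[of P "X - P"] P Va by auto
qed

lemma gens_orth: assumes "X \<in> gens" "Y \<in> perp_gens" shows "ip X Y = 0"
proof -
  consider \<beta> where "\<beta> \<in> \<Lambda> - \<Lambda>'" "X = B \<beta>" | \<alpha> where "\<alpha> \<in> att" "X \<in> rs \<alpha>"
    using assms(1) unfolding gens_def by blast
  then show ?thesis
  proof cases
    case (1 \<beta>)
    from assms(2) consider "Y \<in> a_perp" | \<gamma> where "Y \<in> rs \<gamma>"
      unfolding perp_gens_def by blast
    then show ?thesis
    proof cases
      case 1
      then show ?thesis using \<open>\<beta> \<in> \<Lambda> - \<Lambda>'\<close> \<open>X = B \<beta>\<close> by (simp add: a_perp_def ip_commute)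
    next
      case (2 \<gamma>)
      then show ?thesis using ip_a_n(1)[OF B_a rs_subset_n] \<open>\<beta> \<in> \<Lambda> - \<Lambda>'\<close> \<open>X = B \<beta>\<close> by simp
    qed
  next
    case X: (2 \<alpha>)
    from assms(2) consider "Y \<in> a_perp" | \<gamma> where "\<gamma> \<in> R - att" "Y \<in> rs \<gamma>"
      unfolding perp_gens_def by blast
    then show ?thesis
    proof cases
      case 1
      then show ?thesis using ip_a_n(2)[OF _ rs_subset_n[OF X(2)]] by (simp add: a_perp_def)
    next
      case (2 \<gamma>)
      then show ?thesis using X att_R[OF X(1)] rs_orth[of \<alpha> \<gamma> X Y] by blast
    qed
  qed
qed

lemma gens_span: "span (gens \<union> perp_gens) = UNIV"
proof -
  let ?S = "span (gens \<union> perp_gens)"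
  have "a \<subseteq> ?S"
  proof
    fix X assume "X \<in> a"
    then obtain P Q where PQ: "X = P + Q" "P \<in> span (B ` (\<Lambda> - \<Lambda>'))" "Q \<in> a_perp"
      by (rule a_splitting)
    have "P \<in> ?S" using PQ(2) span_mono[of "B ` (\<Lambda> - \<Lambda>')" "gens \<union> perp_gens"]
      by (auto simp: gens_def)
    moreover have "Q \<in> ?S" using PQ(3) by (auto simp: perp_gens_def intro: span_base)
    ultimately show "X \<in> ?S" using PQ(1) span_add by blast
  qed
  moreover have "n \<subseteq> ?S"
  proof -
    have "n = span (\<Union>\<alpha>\<in>R. rs \<alpha>)"
      using direct_sum by (simp add: internal_direct_sum_def)
    also have "\<dots> \<subseteq> ?S" by (rule span_mono) (auto simp: gens_def perp_gens_def)
    finally show ?thesis .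
  qed
  ultimately have "span (a \<union> n) \<subseteq> ?S" by (intro span_minimal) auto
  then show ?thesis using a_n_span by blast
qed

lemma attached_totally_geodesic_iff:
  "totally_geodesic br ip (attached_subalgebra br a n \<Lambda> B \<Lambda>') \<longleftrightarrow>
    (\<forall>X\<in>gens. \<forall>Y\<in>gens. \<forall>W\<in>perp_gens. ip (br W X) Y + ip (br W Y) X = 0)"
  unfolding attached_subalgebra_def gens_def[symmetric]
  using bil_br nondegenerate gens_orth gens_span by (rule totally_geodesic_iff)

lemma orthogonal_if_totally_geodesic:
  assumes tg: "\<forall>X\<in>gens. \<forall>Y\<in>gens. \<forall>W\<in>perp_gens. ip (br W X) Y + ip (br W Y) X = 0"
    and \<alpha>: "\<alpha> \<in> \<Lambda>'" and \<beta>: "\<beta> \<in> \<Lambda> - \<Lambda>'"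
  shows "dual_ip ip a \<alpha> \<beta> = 0"
proof -
  have \<beta>d: "\<beta> \<in> dual_space a" and \<alpha>d: "\<alpha> \<in> dual_space a" using \<alpha> \<beta> subset \<Lambda>_dual by auto
  obtain P Q where PQ: "H \<beta> = P + Q" "P \<in> span (B ` (\<Lambda> - \<Lambda>'))" "P \<in> a" "Q \<in> a_perp"
    using a_splitting[OF H(1)[OF \<beta>d]] .
  have Qa: "Q \<in> a" using PQ(4) by (simp add: a_perp_def)
  have "\<beta> Q = 0"
  proof -
    have \<beta>R: "\<beta> \<in> R" and \<beta>att: "\<beta> \<in> att" using \<beta> \<Lambda>_R simple_attached by auto
    obtain X where X: "X \<in> rs \<beta>" "X \<noteq> 0" using rs_nonzero[OF \<beta>R] by blast
    have "nondegenerate_on (rs \<beta>) ip"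
      using decomposition \<beta>R unfolding root_decomposition_def by blast
    then obtain Y where Y: "Y \<in> rs \<beta>" "ip X Y \<noteq> 0"
      using X unfolding nondegenerate_on_def by blast
    have "ip (br Q X) Y + ip (br Q Y) X = 0"
      using tg X Y \<beta>att PQ(4) unfolding gens_def perp_gens_def by blast
    then show ?thesis
      using br_a_rs[OF X(1) Qa] br_a_rs[OF Y(1) Qa] Y(2) by (simp add: ip_simps ip_commute[of Y X])
  qed
  moreover have "ip Q P = 0"
    using linear_eq_0_on_span[OF linear_ip _ PQ(2), of Q] PQ(4) by (auto simp: a_perp_def)
  ultimately have "ip Q Q = 0"
    using H(2)[OF \<beta>d Qa] PQ(1) by (simp add: ip_simps ip_commute[of P Q])
  then have "H \<beta> = P" using PQ(1) Qa a_pos by fastforce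
  moreover have "ip (H \<alpha>) P = 0"
  proof -
    have "ip (H \<alpha>) X = 0" if "X \<in> B ` (\<Lambda> - \<Lambda>')" for X
    proof -
      obtain \<delta> where \<delta>: "\<delta> \<in> \<Lambda> - \<Lambda>'" "X = B \<delta>" using \<open>X \<in> B ` (\<Lambda> - \<Lambda>')\<close> by blast
      moreover have "\<alpha> \<in> \<Lambda>" "\<alpha> \<noteq> \<delta>" using \<alpha> subset \<delta> by auto
      ultimately show ?thesis using H(2)[OF \<alpha>d B_a[of \<delta>]] \<Lambda>_B[of \<alpha> \<delta>] by simp
    qed
    then show ?thesis using linear_eq_0_on_span[OF linear_ip _ PQ(2)] by blast
  qed
  ultimately show ?thesis by (simp add: dual_ip_def)
qed

lemma totally_geodesic_if_orthogonal:
  assumes orth: "\<forall>\<alpha>\<in>\<Lambda>'. \<forall>\<beta>\<in>\<Lambda> - \<Lambda>'. dual_ip ip a \<alpha> \<beta> = 0"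
    and "X \<in> gens" "Y \<in> gens" "W \<in> perp_gens"
  shows "ip (br W X) Y = 0"
proof -
  note att0 = attached_coefficient[OF orth]
  from \<open>W \<in> perp_gens\<close> consider "W \<in> a_perp" | \<gamma> where "\<gamma> \<in> R - att" "W \<in> rs \<gamma>"
    unfolding perp_gens_def by blast
  then show ?thesis
  proof cases
    case 1
    then have Wa: "W \<in> a" by (simp add: a_perp_def)
    have simple0: "\<beta> W = 0" if \<beta>: "\<beta> \<in> \<Lambda> - \<Lambda>'" for \<beta>
    proof -
      have \<beta>d: "\<beta> \<in> dual_space a" using \<beta> \<Lambda>_dual by blast
      have "\<beta> W = ip W (H \<beta>)" using H(2)[OF \<beta>d Wa] ip_commute by simp
      also have "\<dots> = ip W (\<Sum>\<delta>\<in>\<Lambda>. \<delta> (H \<beta>) *\<^sub>R B \<delta>)"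
        using a_expansion[OF H(1)[OF \<beta>d]] by simp
      also have "\<dots> = (\<Sum>\<delta>\<in>\<Lambda>. \<delta> (H \<beta>) * ip W (B \<delta>))"
        by (simp add: linear_sum[OF linear_ip] ip_simps)
      also have "\<dots> = 0"
      proof (rule sum.neutral, rule ballI)
        fix \<delta> assume \<delta>: "\<delta> \<in> \<Lambda>"
        show "\<delta> (H \<beta>) * ip W (B \<delta>) = 0"
        proof (cases "\<delta> \<in> \<Lambda>'")
          case True
          then show ?thesis using orth \<beta> dual_ip_eq[OF \<Lambda>_dual[OF \<delta>] \<beta>d] by simp
        next
          case False
          then show ?thesis using \<open>W \<in> a_perp\<close> \<delta> by (simp add: a_perp_def)
        qed
      qed
      finally show ?thesis .
    qed
    from \<open>X \<in> gens\<close> consider "X \<in> a" | \<alpha> where "\<alpha> \<in> att" "X \<in> rs \<alpha>"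
      unfolding gens_def using B_a by blast
    then show ?thesis
    proof cases
      case 1
      then show ?thesis using a_abelian Wa by (simp add: ip_simps)
    next
      case (2 \<alpha>)
      have "\<alpha> W = (\<Sum>\<beta>\<in>\<Lambda>. \<alpha> (B \<beta>) * \<beta> W)"
        by (rule dual_expansion[OF R_dual_space[OF att_R[OF 2(1)]] Wa])
      also have "\<dots> = 0"
      proof (rule sum.neutral, rule ballI)
        fix \<beta> assume "\<beta> \<in> \<Lambda>"
        then show "\<alpha> (B \<beta>) * \<beta> W = 0"
          using simple0[of \<beta>] att0[OF 2(1), of \<beta>] by (cases "\<beta> \<in> \<Lambda>'") simp_all
      qed
      finally show ?thesis using br_a_rs[OF 2(2) Wa] by (simp add: ip_simps)
    qed
  next
    case (2 \<gamma>)
    from \<open>Y \<in> gens\<close> consider "Y \<in> a" | \<beta> where "\<beta> \<in> att" "Y \<in> rs \<beta>"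
      unfolding gens_def using B_a by blast
    then show ?thesis
    proof cases
      case 1
      then show ?thesis using ip_a_n br_in_n by blast
    next
      case Y: (2 \<beta>)
      from \<open>X \<in> gens\<close> consider "X \<in> a" | \<alpha> where "\<alpha> \<in> att" "X \<in> rs \<alpha>"
        unfolding gens_def using B_a by blast
      then show ?thesis
      proof cases
        case 1
        have "ip W Y = 0" using rs_orth[of \<gamma> \<beta> W Y] 2 Y att_R by blast
        then show ?thesis
          using br_anticommute[of W X] br_a_rs[OF 2(2) 1] bilinear_lneg[OF bil_ip]
          by (simp add: ip_simps)
      next
        case X: (2 \<alpha>)
        have br: "br W X \<in> rs (\<gamma> + \<alpha>)" using rs_bracket 2(2) X(2) by blast
        show ?thesis
        proof (cases "\<gamma> + \<alpha> \<in> R")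
          case True
          have "\<gamma> + \<alpha> \<noteq> \<beta>"
          proof
            assume eq: "\<gamma> + \<alpha> = \<beta>"
            have "\<gamma> (B \<delta>) = 0" if \<delta>: "\<delta> \<in> \<Lambda>" for \<delta>
            proof (cases "\<delta> \<in> \<Lambda>'")
              case True
              then show ?thesis
                using att0[OF X(1) True] att0[OF Y(1) True] fun_cong[OF eq, of "B \<delta>"] by simp
            next
              case False
              then show ?thesis using unattached_coefficient[OF 2(1)] \<delta> by simp
            qed
            then show False
              using zero_not_root[of \<gamma>] dual_expansion[of \<gamma>] R_dual_space[of \<gamma>] 2(1) by auto
          qed
          then show ?thesis using rs_orth[OF True att_R[OF Y(1)] _ br Y(2)] by blast
        next
          case False
          then have "rs (\<gamma> + \<alpha>) = {0}"
            using dual_space_add[of \<gamma> \<alpha>] R_dual_space[of \<gamma>] R_dual_space[OF att_R[OF X(1)]] 2(1)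
        by (simp add: roots_def)
          then show ?thesis using br by (simp add: ip_simps)
        qed
      qed
    qed
  qed
qed

end

theorem proposition4p8:
  fixes br :: "'a::real_vector \<Rightarrow> 'a \<Rightarrow> 'a" and ip :: "'a \<Rightarrow> 'a \<Rightarrow> real"
    and a n :: "'a set" and \<Lambda> \<Lambda>' :: "('a \<Rightarrow> real) set" and B :: "('a \<Rightarrow> real) \<Rightarrow> 'a"
  assumes "strong_iwasawa br ip a n"
    and "root_decomposition br ip a n"
    and "simple_roots br a n \<Lambda>"
    and "dual_basis a \<Lambda> B"
    and "\<Lambda>' \<subset> \<Lambda>"
    and "attachable br ip a n \<Lambda> B \<Lambda>'"
  shows "totally_geodesic br ip (attached_subalgebra br a n \<Lambda> B \<Lambda>') \<longleftrightarrow>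
    (\<forall>\<alpha>\<in>\<Lambda>'. \<forall>\<beta>\<in>\<Lambda> - \<Lambda>'. dual_ip ip a \<alpha> \<beta> = 0)"
proof -
  interpret attached_setup br ip a n \<Lambda> \<Lambda>' B
    using assms by unfold_locales
  show ?thesis
    unfolding attached_totally_geodesic_iff
    using orthogonal_if_totally_geodesic totally_geodesic_if_orthogonal by auto
qed

end
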